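(* Let $N$ be a finite nonempty set of agents and $\Phi$ a countable set of atomic propositions. For every $\emptyset\neq G\subseteq N$ and all formulas $\varphi,\psi\in\mathcal{L}$, the following formulas are valid (true at every path and every stage of every iCGS over $N,\Phi$): 1. $\models \langle\langle G\rangle\rangle\Box\varphi\leftrightarrow D_G\varphi\wedge\langle\langle G\rangle\rangle\bigcirc\langle\langle G\rangle\rangle\Box\varphi$; 2. $\models \langle\langle G\rangle\rangle\Diamond\varphi\rightarrow\widehat{D}_G\varphi\vee\langle\langle G\rangle\rangle\bigcirc\langle\langle G\rangle\rangle\Diamond\varphi$; 3. $\models D_G\varphi\vee\langle\langle G\rangle\rangle\bigcirc\langle\langle G\rangle\rangle\Diamond\varphi\rightarrow\langle\langle G\rangle\rangle\Diamond\varphi$; 4. $\models \langle\langle G\rangle\rangle\varphi\,\mathcal{U}\,\psi\rightarrow\widehat{D}_G\psi\vee(D_G\varphi\wedge\langle\langle G\rangle\rangle\bigcirc\langle\langle G\rangle\rangle\varphi\,\mathcal{U}\,\psi)$; 5. $\models D_G\psi\vee(D_G\varphi\wedge\langle\langle G\rangle\rangle\bigcirc\langle\langle G\rangle\rangle\varphi\,\mathcal{U}\,\psi)\rightarrow\langle\langle G\rangle\rangle\varphi\,\mathcal{U}\,\psi$.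
   Context: Language. $\Phi$ is a countable set of atomic propositions and $N$ a finite nonempty set of agents. The language $\mathcal{L}$ is given by $\varphi := p \mid \neg\varphi \mid \varphi\wedge\varphi \mid \langle\langle G\rangle\rangle\bigcirc\varphi \mid \langle\langle G\rangle\rangle\Box\varphi \mid \langle\langle G\rangle\rangle\varphi\,\mathcal{U}\,\varphi$ with $p\in\Phi$ and $\emptyset\neq G\subseteq N$. Other Boolean connectives and $\top,\bot$ are the usual abbreviations. $\langle\langle G\rangle\rangle\Diamond\varphi$ abbreviates $\langle\langle G\rangle\rangle\top\,\mathcal{U}\,\varphi$; $D_G\varphi$ abbreviates $\langle\langle G\rangle\rangle\varphi\,\mathcal{U}\,\varphi$; $\widehat{D}_G\varphi$ abbreviates $\neg D_G\neg\varphi$. Models. An imperfect information concurrent game structure (iCGS) is $M=(N,\Phi,W,\mathcal{A},\pi,d,\delta,\{R_i\}_{i\in N})$ with $N=\{1,\dots,k\}$; $W$ a nonempty finite set of states; $\mathcal{A}$ a nonempty finite set of actions; $\pi:\Phi\to\wp(W)$ a valuation; $d$ assigning to each $i\in N$, $w\in W$ a nonempty set $d_i(w)\subseteq\mathcal{A}$ of available actions, with $D(w)=d_1(w)\times\cdots\times d_k(w)$; $\delta$ a transition function giving $\delta(w,\alpha)\in W$ for each $w\in W$, $\alpha\in D(w)$; each $R_i$ an equivalence relation on $W$ such that $wR_iw'$ implies $d_i(w)=d_i(w')$. Paths and histories. A path $\lambda$ is an infinite sequence $w_0\stackrel{\alpha_1}{\to}w_1\stackrel{\alpha_2}{\to}w_2\cdots$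 with $\alpha_j\in D(w_{j-1})$ and $\delta(w_{j-1},\alpha_j)=w_j$ for all $j\ge1$ ($w_0\in W$ arbitrary). $\lambda[j]=w_j$; $\lambda[j,k]$ is the segment from the $j$-th to the $k$-th state (including actions). A history is a finite segment of a path; $H$ is the set of histories, $|h|$ is the number of actions in $h$, and $last(h)$ its last state. $\alpha(i)$ is the $i$-th component of $\alpha$, and $\theta_i(\lambda,j)=\alpha_{j+1}(i)$ is the action of $i$ taken at stage $j$ on $\lambda$. Indistinguishability. Histories $h=w_0\stackrel{\alpha_1}{\to}\cdots\stackrel{\alpha_m}{\to}w_m$ and $h'=w'_0\stackrel{\alpha'_1}{\to}\cdots\stackrel{\alpha'_n}{\to}w'_n$ satisfy $h\approx_i h'$ iff $m=n$, $w_jR_iw'_j$ for all $0\le j\le m$, and $\alpha_l(i)=\alpha'_l(i)$ for all $1\le l\le m$. For $G\neq\emptyset$, $\approx_G=\bigcap_{i\in G}\approx_i$. For paths, $\lambda\approx_G^j\lambda'$ iff $\lambda[0,j]\approx_G\lambda'[0,j]$, and $\approx_G^j(\lambda)=\{\lambda' : \lambda\approx_G^j\lambda'\}$. Strategies. For $i\in G$, a (uniform perfect recall) strategy for $i$ w.r.t. $G$ is $f_i:H\to\mathcal{A}$ with $f_i(h)\in d_i(last(h))$ for all $h$, and $f_i(h)=f_i(h')$ whenever $h\approx_G h'$. A joint strategy $F_G=\langle f_i\rangle_{i\in G}$ consists of one such strategy for each $i\in G$. $\mathcal{P}(h,f_i)$ is the set of paths $\lambda$ with $\lambda[0,|h|]=h$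 and $f_i(\lambda[0,j])=\theta_i(\lambda,j)$ for all $j\ge|h|$; $\mathcal{P}(h,F_G)=\bigcap_{i\in G}\mathcal{P}(h,f_i)$. Satisfaction at path $\lambda$ and stage $j\in\mathbb{N}$. $M,\lambda,j\models p$ iff $\lambda[j]\in\pi(p)$; $\neg,\wedge$ as usual; - $M,\lambda,j\models\langle\langle G\rangle\rangle\bigcirc\varphi$ iff there is $F_G$ such that for all $\lambda'\in\approx_G^j(\lambda)$ and all $\lambda''\in\mathcal{P}(\lambda'[0,j],F_G)$: $M,\lambda'',j+1\models\varphi$; - $M,\lambda,j\models\langle\langle G\rangle\rangle\Box\varphi$ iff there is $F_G$ such that for all such $\lambda',\lambda''$ and all $k\ge j$: $M,\lambda'',k\models\varphi$; - $M,\lambda,j\models\langle\langle G\rangle\rangle\varphi_1\,\mathcal{U}\,\varphi_2$ iff there is $F_G$ such that for all such $\lambda',\lambda''$ there is $k\ge j$ with $M,\lambda'',k\models\varphi_2$ and $M,\lambda'',t\models\varphi_1$ for all $j\le t<k$. $\varphi$ is valid, $\models\varphi$, iff $M,\lambda,j\models\varphi$ for every iCGS $M$, path $\lambda$ of $M$ and stage $j\in\mathbb{N}$. *)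

theory Defs
  imports Main "HOL-Library.FuncSet" "HOL-Library.Countable_Set"
begin

section \<open>Language\<close>

datatype ('p, 'ag) fm =
    Atom 'p
  | Neg "('p, 'ag) fm"
  | And "('p, 'ag) fm" "('p, 'ag) fm"
  | Next "'ag set" "('p, 'ag) fm"
  | Always "'ag set" "('p, 'ag) fm"
  | Until "'ag set" "('p, 'ag) fm" "('p, 'ag) fm"

inductive_set lang :: "'ag set \<Rightarrow> 'p set \<Rightarrow> ('p, 'ag) fm set"
  for N :: "'ag set" and \<Phi> :: "'p set" where
  "p \<in> \<Phi> \<Longrightarrow> Atom p \<in> lang N \<Phi>"
| "\<phi> \<in> lang N \<Phi> \<Longrightarrow> Neg \<phi> \<in> lang N \<Phi>"
| "\<phi> \<in> lang N \<Phi> \<Longrightarrow> \<psi> \<in> lang N \<Phi> \<Longrightarrow> And \<phi> \<psi> \<in> lang N \<Phi>"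
| "G \<noteq> {} \<Longrightarrow> G \<subseteq> N \<Longrightarrow> \<phi> \<in> lang N \<Phi> \<Longrightarrow> Next G \<phi> \<in> lang N \<Phi>"
| "G \<noteq> {} \<Longrightarrow> G \<subseteq> N \<Longrightarrow> \<phi> \<in> lang N \<Phi> \<Longrightarrow> Always G \<phi> \<in> lang N \<Phi>"
| "G \<noteq> {} \<Longrightarrow> G \<subseteq> N \<Longrightarrow> \<phi> \<in> lang N \<Phi> \<Longrightarrow> \<psi> \<in> lang N \<Phi> \<Longrightarrow> Until G \<phi> \<psi> \<in> lang N \<Phi>"

definition Or :: "('p, 'ag) fm \<Rightarrow> ('p, 'ag) fm \<Rightarrow> ('p, 'ag) fm" where
  "Or \<phi> \<psi> = Neg (And (Neg \<phi>) (Neg \<psi>))"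

definition Imp :: "('p, 'ag) fm \<Rightarrow> ('p, 'ag) fm \<Rightarrow> ('p, 'ag) fm" where
  "Imp \<phi> \<psi> = Or (Neg \<phi>) \<psi>"

definition Iff :: "('p, 'ag) fm \<Rightarrow> ('p, 'ag) fm \<Rightarrow> ('p, 'ag) fm" where
  "Iff \<phi> \<psi> = And (Imp \<phi> \<psi>) (Imp \<psi> \<phi>)"

text \<open>
  Verum is the tautology built from some fixed proposition of \<open>\<Phi>\<close>, so that it belongs to the
  language. If \<open>\<Phi>\<close> is empty, then so is the language, and the choice is immaterial.
\<close>

definition Top :: "'p set \<Rightarrow> ('p, 'ag) fm" where
  "Top \<Phi> = (let p = (SOME p. p \<in> \<Phi>) in Or (Atom p) (Neg (Atom p)))"

definition Eventually :: "'p set \<Rightarrow> 'ag set \<Rightarrow> ('p, 'ag) fm \<Rightarrow> ('p, 'ag) fm" where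
  "Eventually \<Phi> G \<phi> = Until G (Top \<Phi>) \<phi>"

definition Dist :: "'ag set \<Rightarrow> ('p, 'ag) fm \<Rightarrow> ('p, 'ag) fm" where
  "Dist G \<phi> = Until G \<phi> \<phi>"

definition Dist_dual :: "'ag set \<Rightarrow> ('p, 'ag) fm \<Rightarrow> ('p, 'ag) fm" where
  "Dist_dual G \<phi> = Neg (Dist G (Neg \<phi>))"

lemma Top_in_lang: "\<Phi> \<noteq> {} \<Longrightarrow> Top \<Phi> \<in> lang N \<Phi>"
  by (auto simp: Top_def Or_def Let_def some_in_eq intro!: lang.intros)


section \<open>Imperfect information concurrent game structures\<close>

record ('p, 'ag, 's, 'act) icgs =
  agents :: "'ag set"
  props :: "'p set"
  states :: "'s set"
  actions :: "'act set"
  val :: "'p \<Rightarrow> 's set"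
  avail :: "'ag \<Rightarrow> 's \<Rightarrow> 'act set"
  step :: "'s \<Rightarrow> ('ag \<Rightarrow> 'act) \<Rightarrow> 's"
  indist :: "'ag \<Rightarrow> 's rel"

text \<open>Members of the product are extensional functions, i.e. \<open>undefined\<close> outside the agents.\<close>

definition profiles :: "('p, 'ag, 's, 'act) icgs \<Rightarrow> 's \<Rightarrow> ('ag \<Rightarrow> 'act) set" where
  "profiles M w = (\<Pi>\<^sub>E i\<in>agents M. avail M i w)"

locale iCGS =
  fixes M :: "('p, 'ag, 's, 'act) icgs"
  assumes finite_agents: "finite (agents M)"
    and agents_nonempty: "agents M \<noteq> {}"
    and countable_props: "countable (props M)"
    and finite_states: "finite (states M)"
    and states_nonempty: "states M \<noteq> {}"
    and finite_actions: "finite (actions M)"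
    and actions_nonempty: "actions M \<noteq> {}"
    and val_subset: "p \<in> props M \<Longrightarrow> val M p \<subseteq> states M"
    and avail_subset: "i \<in> agents M \<Longrightarrow> w \<in> states M \<Longrightarrow> avail M i w \<subseteq> actions M"
    and avail_nonempty: "i \<in> agents M \<Longrightarrow> w \<in> states M \<Longrightarrow> avail M i w \<noteq> {}"
    and step_in_states: "w \<in> states M \<Longrightarrow> \<alpha> \<in> profiles M w \<Longrightarrow> step M w \<alpha> \<in> states M"
    and indist_equiv: "i \<in> agents M \<Longrightarrow> equiv (states M) (indist M i)"
    and indist_avail: "i \<in> agents M \<Longrightarrow> (w, w') \<in> indist M i \<Longrightarrow> avail M i w = avail M i w'"


section \<open>Paths and histories\<close>

text \<open>
  A path is given by its sequence of states \<open>w\<^sub>0, w\<^sub>1, \<dots>\<close> and its sequence of action profiles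
  \<open>\<alpha>\<^sub>1, \<alpha>\<^sub>2, \<dots>\<close>. The profiles are stored from index 0 on: \<open>pact \<rho> j\<close> is \<open>\<alpha>\<close> with index \<open>j + 1\<close>,
  the profile taken at stage \<open>j\<close>.
\<close>

type_synonym ('ag, 's, 'act) path = "(nat \<Rightarrow> 's) \<times> (nat \<Rightarrow> 'ag \<Rightarrow> 'act)"

abbreviation pstate :: "('ag, 's, 'act) path \<Rightarrow> nat \<Rightarrow> 's" where
  "pstate \<rho> \<equiv> fst \<rho>"

abbreviation pact :: "('ag, 's, 'act) path \<Rightarrow> nat \<Rightarrow> 'ag \<Rightarrow> 'act" where
  "pact \<rho> \<equiv> snd \<rho>"

definition paths :: "('p, 'ag, 's, 'act) icgs \<Rightarrow> ('ag, 's, 'act) path set" where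
  "paths M = {\<rho>. pstate \<rho> 0 \<in> states M \<and>
     (\<forall>j. pact \<rho> j \<in> profiles M (pstate \<rho> j) \<and>
          step M (pstate \<rho> j) (pact \<rho> j) = pstate \<rho> (Suc j))}"

text \<open>
  A history consists of its initial state and the list of its steps, each step being an action
  profile together with the state it leads to.
\<close>

type_synonym ('ag, 's, 'act) hist = "'s \<times> (('ag \<Rightarrow> 'act) \<times> 's) list"

definition hstates :: "('ag, 's, 'act) hist \<Rightarrow> 's list" where
  "hstates h = fst h # map snd (snd h)"

definition hacts :: "('ag, 's, 'act) hist \<Rightarrow> ('ag \<Rightarrow> 'act) list" where
  "hacts h = map fst (snd h)"

definition hlen :: "('ag, 's, 'act) hist \<Rightarrow> nat" where
  "hlen h = length (hacts h)"

definition hlast :: "('ag, 's, 'act) hist \<Rightarrow> 's" where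
  "hlast h = last (hstates h)"

definition segment :: "('ag, 's, 'act) path \<Rightarrow> nat \<Rightarrow> nat \<Rightarrow> ('ag, 's, 'act) hist" where
  "segment \<rho> j k = (pstate \<rho> j, map (\<lambda>t. (pact \<rho> t, pstate \<rho> (Suc t))) [j..<k])"

definition histories :: "('p, 'ag, 's, 'act) icgs \<Rightarrow> ('ag, 's, 'act) hist set" where
  "histories M = {segment \<rho> j k | \<rho> j k. \<rho> \<in> paths M \<and> j \<le> k}"


section \<open>Indistinguishability\<close>

definition hist_indist ::
  "('p, 'ag, 's, 'act) icgs \<Rightarrow> 'ag \<Rightarrow> ('ag, 's, 'act) hist \<Rightarrow> ('ag, 's, 'act) hist \<Rightarrow> bool" where
  "hist_indist M i h h' \<longleftrightarrow> hlen h = hlen h' \<and>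
     (\<forall>j\<le>hlen h. (hstates h ! j, hstates h' ! j) \<in> indist M i) \<and>
     (\<forall>l<hlen h. (hacts h ! l) i = (hacts h' ! l) i)"

definition hist_indist_grp ::
  "('p, 'ag, 's, 'act) icgs \<Rightarrow> 'ag set \<Rightarrow> ('ag, 's, 'act) hist \<Rightarrow> ('ag, 's, 'act) hist \<Rightarrow> bool" where
  "hist_indist_grp M G h h' \<longleftrightarrow> (\<forall>i\<in>G. hist_indist M i h h')"

definition path_class ::
  "('p, 'ag, 's, 'act) icgs \<Rightarrow> 'ag set \<Rightarrow> nat \<Rightarrow> ('ag, 's, 'act) path \<Rightarrow> ('ag, 's, 'act) path set"
  where
  "path_class M G j \<rho> = {\<sigma> \<in> paths M. hist_indist_grp M G (segment \<rho> 0 j) (segment \<sigma> 0 j)}"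


section \<open>Strategies\<close>

definition strategy ::
  "('p, 'ag, 's, 'act) icgs \<Rightarrow> 'ag set \<Rightarrow> 'ag \<Rightarrow> (('ag, 's, 'act) hist \<Rightarrow> 'act) \<Rightarrow> bool" where
  "strategy M G i f \<longleftrightarrow>
     (\<forall>h\<in>histories M. f h \<in> avail M i (hlast h)) \<and>
     (\<forall>h\<in>histories M. \<forall>h'\<in>histories M. hist_indist_grp M G h h' \<longrightarrow> f h = f h')"

definition joint_strategy ::
  "('p, 'ag, 's, 'act) icgs \<Rightarrow> 'ag set \<Rightarrow> ('ag \<Rightarrow> ('ag, 's, 'act) hist \<Rightarrow> 'act) \<Rightarrow> bool" where
  "joint_strategy M G F \<longleftrightarrow> (\<forall>i\<in>G. strategy M G i (F i))"

definition outcomes ::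
  "('p, 'ag, 's, 'act) icgs \<Rightarrow> ('ag, 's, 'act) hist \<Rightarrow> 'ag \<Rightarrow> (('ag, 's, 'act) hist \<Rightarrow> 'act)
     \<Rightarrow> ('ag, 's, 'act) path set" where
  "outcomes M h i f = {\<rho> \<in> paths M. segment \<rho> 0 (hlen h) = h \<and>
     (\<forall>j\<ge>hlen h. f (segment \<rho> 0 j) = pact \<rho> j i)}"

definition joint_outcomes ::
  "('p, 'ag, 's, 'act) icgs \<Rightarrow> ('ag, 's, 'act) hist \<Rightarrow> 'ag set
     \<Rightarrow> ('ag \<Rightarrow> ('ag, 's, 'act) hist \<Rightarrow> 'act) \<Rightarrow> ('ag, 's, 'act) path set" where
  "joint_outcomes M h G F = (\<Inter>i\<in>G. outcomes M h i (F i))"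


section \<open>Satisfaction and validity\<close>

primrec sat ::
  "('p, 'ag, 's, 'act) icgs \<Rightarrow> ('ag, 's, 'act) path \<Rightarrow> nat \<Rightarrow> ('p, 'ag) fm \<Rightarrow> bool" where
  "sat M \<rho> j (Atom p) \<longleftrightarrow> pstate \<rho> j \<in> val M p"
| "sat M \<rho> j (Neg \<phi>) \<longleftrightarrow> \<not> sat M \<rho> j \<phi>"
| "sat M \<rho> j (And \<phi> \<psi>) \<longleftrightarrow> sat M \<rho> j \<phi> \<and> sat M \<rho> j \<psi>"
| "sat M \<rho> j (Next G \<phi>) \<longleftrightarrow>
     (\<exists>F. joint_strategy M G F \<and>
       (\<forall>\<sigma> \<in> path_class M G j \<rho>. \<forall>\<tau> \<in> joint_outcomes M (segment \<sigma> 0 j) G F.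
         sat M \<tau> (j + 1) \<phi>))"
| "sat M \<rho> j (Always G \<phi>) \<longleftrightarrow>
     (\<exists>F. joint_strategy M G F \<and>
       (\<forall>\<sigma> \<in> path_class M G j \<rho>. \<forall>\<tau> \<in> joint_outcomes M (segment \<sigma> 0 j) G F.
         \<forall>k\<ge>j. sat M \<tau> k \<phi>))"
| "sat M \<rho> j (Until G \<phi> \<psi>) \<longleftrightarrow>
     (\<exists>F. joint_strategy M G F \<and>
       (\<forall>\<sigma> \<in> path_class M G j \<rho>. \<forall>\<tau> \<in> joint_outcomes M (segment \<sigma> 0 j) G F.
         \<exists>k\<ge>j. sat M \<tau> k \<psi> \<and> (\<forall>t. j \<le> t \<and> t < k \<longrightarrow> sat M \<tau> t \<phi>)))"

text \<open>
  HOL cannot quantify over types inside a formula, so the types from which states and actions are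
  drawn are parameters. A theorem in which \<open>'s\<close> and \<open>'act\<close> are type variables speaks about all
  structures.
\<close>

definition valid ::
  "'s itself \<Rightarrow> 'act itself \<Rightarrow> 'ag set \<Rightarrow> 'p set \<Rightarrow> ('p, 'ag) fm \<Rightarrow> bool" where
  "valid _ _ N \<Phi> \<chi> \<longleftrightarrow>
     (\<forall>M :: ('p, 'ag, 's, 'act) icgs. iCGS M \<and> agents M = N \<and> props M = \<Phi> \<longrightarrow>
       (\<forall>\<rho>\<in>paths M. \<forall>j. sat M \<rho> j \<chi>))"

end

theory Submission
  imports Defs
begin

text \<open>
  Satisfaction at stage \<open>j\<close> depends only on the history up to \<open>j\<close>, and every joint strategy can be
  followed from every history; hence \<open>D\<^sub>G \<phi>\<close> says that \<open>\<phi>\<close> holds throughout the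
  \<open>\<approx>\<^sub>G\<close>-class of the current history. The unfolding directions then follow because, by uniformity,
  a strategy that enforces a property from stage \<open>j\<close> still enforces it from stage \<open>j + 1\<close>. For the
  folding directions, strategies chosen at stage \<open>j + 1\<close>, one for each \<open>\<approx>\<^sub>G\<close>-class of histories,
  are glued to the strategy for the next step; choosing by class keeps the result uniform.
\<close>

section \<open>Histories as initial segments of paths\<close>

lemma hlen_segment [simp]: "hlen (segment \<rho> 0 n) = n"
  by (simp add: hlen_def hacts_def segment_def)

lemma hstates_segment: "hstates (segment \<rho> 0 n) = map (pstate \<rho>) [0..<Suc n]"
proof -
  have "pstate \<rho> 0 # map (\<lambda>t. pstate \<rho> (Suc t)) [0..<n] = map (pstate \<rho>) [0..<Suc n]"
    by (simp add: upt_conv_Cons map_Suc_upt [symmetric] o_def del: upt_Suc)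
  then show ?thesis
    by (simp add: hstates_def segment_def o_def)
qed

lemma hlast_segment [simp]: "hlast (segment \<rho> 0 n) = pstate \<rho> n"
  by (simp add: hlast_def hstates_segment)

lemma nth_hstates_segment [simp]: "t \<le> n \<Longrightarrow> hstates (segment \<rho> 0 n) ! t = pstate \<rho> t"
  by (simp add: hstates_segment del: upt_Suc)

lemma nth_hacts_segment [simp]: "t < n \<Longrightarrow> hacts (segment \<rho> 0 n) ! t = pact \<rho> t"
  by (simp add: hacts_def segment_def)

lemma segment_eq_iff:
  "segment \<rho> 0 n = segment \<sigma> 0 n \<longleftrightarrow>
     (\<forall>t\<le>n. pstate \<rho> t = pstate \<sigma> t) \<and> (\<forall>t<n. pact \<rho> t = pact \<sigma> t)"
  (is "?L \<longleftrightarrow> ?R")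
proof
  assume L: ?L
  have "pstate \<rho> t = pstate \<sigma> t" if "t \<le> n" for t
    using L that by (cases t) (auto simp: segment_def)
  then show ?R
    using L by (auto simp: segment_def)
qed (auto simp: segment_def)

lemma hist_indist_segment:
  "hist_indist M i (segment \<rho> 0 n) (segment \<sigma> 0 n) \<longleftrightarrow>
     (\<forall>t\<le>n. (pstate \<rho> t, pstate \<sigma> t) \<in> indist M i) \<and> (\<forall>t<n. pact \<rho> t i = pact \<sigma> t i)"
  by (simp add: hist_indist_def)

lemma path_shift: "\<rho> \<in> paths M \<Longrightarrow> pstate \<rho> j \<in> states M \<Longrightarrow>
    (\<lambda>t. pstate \<rho> (j + t), \<lambda>t. pact \<rho> (j + t)) \<in> paths M"
  by (simp add: paths_def)

lemma segment_shift:
  assumes "j \<le> k"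
  shows "segment \<rho> j k = segment (\<lambda>t. pstate \<rho> (j + t), \<lambda>t. pact \<rho> (j + t)) 0 (k - j)"
  using assms by (auto simp: segment_def intro!: nth_equalityI)

text \<open>A strategy is given a history, not a path. Truncation lets the glued strategy recover
  the point at which its continuation was chosen.\<close>

definition htake :: "nat \<Rightarrow> ('ag, 's, 'act) hist \<Rightarrow> ('ag, 's, 'act) hist" where
  "htake n h = (fst h, take n (snd h))"

lemma htake_segment [simp]: "htake n (segment \<rho> 0 k) = segment \<rho> 0 (min n k)"
  by (simp add: htake_def segment_def take_map take_upt min_def)

lemma sat_Top [simp]: "sat M \<rho> j (Top \<Phi>)"
  by (simp add: Top_def Or_def Let_def)

lemma sat_Or [simp]: "sat M \<rho> j (Or \<phi> \<psi>) \<longleftrightarrow> sat M \<rho> j \<phi> \<or> sat M \<rho> j \<psi>"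
  by (simp add: Or_def)

lemma sat_Imp [simp]: "sat M \<rho> j (Imp \<phi> \<psi>) \<longleftrightarrow> (sat M \<rho> j \<phi> \<longrightarrow> sat M \<rho> j \<psi>)"
  by (auto simp: Imp_def)

lemma sat_Iff [simp]: "sat M \<rho> j (Iff \<phi> \<psi>) \<longleftrightarrow> (sat M \<rho> j \<phi> \<longleftrightarrow> sat M \<rho> j \<psi>)"
  by (auto simp: Iff_def)

text \<open>Atoms look only at the state at stage \<open>j\<close>, and the strategic clauses
  mention the current path only through \<open>path_class\<close>, which is determined by the
  segment up to \<open>j\<close>.\<close>

lemma sat_segment_cong:
  assumes "segment \<rho> 0 j = segment \<sigma> 0 j"
  shows "sat M \<rho> j \<phi> \<longleftrightarrow> sat M \<sigma> j \<phi>"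
proof -
  have "pstate \<rho> j = pstate \<sigma> j"
    using assms by (simp add: segment_eq_iff)
  moreover have "path_class M G j \<rho> = path_class M G j \<sigma>" for G
    using assms by (simp add: path_class_def)
  ultimately show ?thesis
    by (induction \<phi>) simp_all
qed

section \<open>Construction of paths\<close>

context iCGS
begin

lemma path_state: "\<rho> \<in> paths M \<Longrightarrow> pstate \<rho> n \<in> states M"
proof (induction n)
  case (Suc n)
  then show ?case
    using step_in_states [of "pstate \<rho> n" "pact \<rho> n"] by (simp add: paths_def)
qed (simp add: paths_def)

text \<open>Dropping the first \<open>j\<close> steps of a path leaves a path, so a segment starting
  at \<open>j\<close> is also an initial segment. Quantifiers over histories thus become quantifiers
  over a path and a stage.\<close>

lemma histories_eq: "histories M = {segment \<rho> 0 k | \<rho> k. \<rho> \<in> paths M}"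
proof
  show "histories M \<subseteq> {segment \<rho> 0 k | \<rho> k. \<rho> \<in> paths M}"
    using path_shift path_state segment_shift unfolding histories_def by fastforce
qed (auto simp: histories_def)

lemma ball_histories: "(\<forall>h\<in>histories M. Q h) \<longleftrightarrow> (\<forall>\<rho>\<in>paths M. \<forall>n. Q (segment \<rho> 0 n))"
  unfolding histories_eq by blast

text \<open>Iterating a rule that picks a legal profile after each history generates a path. The
  rule must be legal wherever the last state lies in \<open>states M\<close>, since the objects
  built are not yet known to be histories.\<close>

lemma path_of_rule:
  assumes w: "w \<in> states M"
    and a: "\<And>h. hlast h \<in> states M \<Longrightarrow> a h \<in> profiles M (hlast h)"
  obtains \<tau> where "\<tau> \<in> paths M" "pstate \<tau> 0 = w" "\<And>n. pact \<tau> n = a (segment \<tau> 0 n)"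
proof -
  \<comment> \<open>The recursion builds whole histories because the rule may depend on all of the
    past; the path is read off afterwards.\<close>
  define H where
    "H = rec_nat (w, []) (\<lambda>_ h. (fst h, snd h @ [(a h, step M (hlast h) (a h))]))"
  define \<tau> where "\<tau> = (\<lambda>n. hlast (H n), \<lambda>n. a (H n))"
  have H0: "H 0 = (w, [])"
    and HS: "H (Suc n) = (fst (H n), snd (H n) @ [(a (H n), step M (hlast (H n)) (a (H n)))])" for n
    by (simp_all add: H_def)
  have lastS: "hlast (H (Suc n)) = step M (hlast (H n)) (a (H n))" for n
    by (simp add: HS hlast_def hstates_def)
  have last0: "hlast (H 0) = w"
    by (simp add: H0 hlast_def hstates_def)
  have st: "hlast (H n) \<in> states M" for n
    by (induction n) (simp_all add: last0 lastS w a step_in_states)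
  have seg: "segment \<tau> 0 n = H n" for n
  proof (induction n)
    case 0
    then show ?case by (simp add: segment_def \<tau>_def H0 hlast_def hstates_def)
  next
    case (Suc n)
    have "segment \<tau> 0 (Suc n) =
        (fst (segment \<tau> 0 n), snd (segment \<tau> 0 n) @ [(pact \<tau> n, pstate \<tau> (Suc n))])"
      by (simp add: segment_def)
    also have "\<dots> = (fst (H n), snd (H n) @ [(a (H n), hlast (H (Suc n)))])"
      unfolding Suc.IH by (simp add: \<tau>_def)
    also have "\<dots> = H (Suc n)"
      unfolding lastS by (simp only: HS)
    finally show ?case .
  qed
  show ?thesis
  proof
    show "\<tau> \<in> paths M"
      using st a by (auto simp: paths_def \<tau>_def lastS)
    show "pstate \<tau> 0 = w"
      by (simp add: \<tau>_def last0)
    show "pact \<tau> n = a (segment \<tau> 0 n)" for n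
      unfolding seg by (simp add: \<tau>_def)
  qed
qed

end

section \<open>Group indistinguishability and joint strategies\<close>

locale coalition = iCGS M for M :: "('p, 'ag, 's, 'act) icgs" +
  fixes G :: "'ag set"
  assumes G_nonempty: "G \<noteq> {}" and G_subset: "G \<subseteq> agents M"
begin

text \<open>Not restricted to paths of \<open>M\<close>: symmetry and transitivity then hold without
  side conditions, and only reflexivity asks for a path.\<close>

definition sim :: "nat \<Rightarrow> ('ag, 's, 'act) path \<Rightarrow> ('ag, 's, 'act) path \<Rightarrow> bool" where
  "sim n \<rho> \<sigma> \<longleftrightarrow> hist_indist_grp M G (segment \<rho> 0 n) (segment \<sigma> 0 n)"

lemma sim_iff:
  "sim n \<rho> \<sigma> \<longleftrightarrow> (\<forall>i\<in>G. (\<forall>t\<le>n. (pstate \<rho> t, pstate \<sigma> t) \<in> indist M i) \<and>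
     (\<forall>t<n. pact \<rho> t i = pact \<sigma> t i))"
  by (simp add: sim_def hist_indist_grp_def hist_indist_segment)

lemma indist_refl: "i \<in> G \<Longrightarrow> w \<in> states M \<Longrightarrow> (w, w) \<in> indist M i"
  using indist_equiv G_subset by (meson equiv_def subsetD refl_onD)

lemma indist_sym: "i \<in> G \<Longrightarrow> (w, w') \<in> indist M i \<Longrightarrow> (w', w) \<in> indist M i"
  using indist_equiv G_subset by (meson equiv_def subsetD symD)

lemma indist_trans:
  "i \<in> G \<Longrightarrow> (w, w') \<in> indist M i \<Longrightarrow> (w', w'') \<in> indist M i \<Longrightarrow> (w, w'') \<in> indist M i"
  using indist_equiv G_subset by (meson equiv_def subsetD transD)

lemma sim_sym: "sim n \<rho> \<sigma> \<Longrightarrow> sim n \<sigma> \<rho>"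
  unfolding sim_iff by (metis indist_sym)

lemma sim_trans: "sim n \<rho> \<sigma> \<Longrightarrow> sim n \<sigma> \<tau> \<Longrightarrow> sim n \<rho> \<tau>"
  unfolding sim_iff by (metis indist_trans)

lemma sim_refl: "\<rho> \<in> paths M \<Longrightarrow> sim n \<rho> \<rho>"
  by (simp add: sim_iff indist_refl path_state)

lemma sim_mono: "sim n \<rho> \<sigma> \<Longrightarrow> m \<le> n \<Longrightarrow> sim m \<rho> \<sigma>"
  by (auto simp: sim_iff)

lemma path_class_iff: "\<sigma> \<in> path_class M G j \<rho> \<longleftrightarrow> \<sigma> \<in> paths M \<and> sim j \<rho> \<sigma>"
  by (simp add: path_class_def sim_def)

lemma joint_strategy_iff:
  "joint_strategy M G F \<longleftrightarrow>
     (\<forall>i\<in>G. \<forall>\<rho>\<in>paths M. \<forall>n. F i (segment \<rho> 0 n) \<in> avail M i (pstate \<rho> n)) \<and>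
     (\<forall>i\<in>G. \<forall>\<rho>\<in>paths M. \<forall>\<sigma>\<in>paths M. \<forall>n. sim n \<rho> \<sigma> \<longrightarrow>
        F i (segment \<rho> 0 n) = F i (segment \<sigma> 0 n))"
proof -
  \<comment> \<open>Since \<open>G\<close> is nonempty, some agent compares the lengths; a single
    stage \<open>n\<close> therefore serves for both histories.\<close>
  have len: "n = m" if "hist_indist_grp M G (segment \<rho> 0 n) (segment \<sigma> 0 m)" for \<rho> \<sigma> n m
    using that G_nonempty by (auto simp: hist_indist_grp_def hist_indist_def)
  have *: "strategy M G i f \<longleftrightarrow>
     (\<forall>\<rho>\<in>paths M. \<forall>n. f (segment \<rho> 0 n) \<in> avail M i (pstate \<rho> n)) \<and>
     (\<forall>\<rho>\<in>paths M. \<forall>\<sigma>\<in>paths M. \<forall>n. sim n \<rho> \<sigma> \<longrightarrow> f (segment \<rho> 0 n) = f (segment \<sigma> 0 n))"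
    (is "_ \<longleftrightarrow> ?A \<and> ?B") for i f
  proof -
    have "(\<forall>h\<in>histories M. f h \<in> avail M i (hlast h)) \<longleftrightarrow> ?A"
      by (simp add: ball_histories)
    moreover have "(\<forall>h\<in>histories M. \<forall>h'\<in>histories M. hist_indist_grp M G h h' \<longrightarrow> f h = f h') \<longleftrightarrow> ?B"
      unfolding ball_histories sim_def using len by blast
    ultimately show ?thesis
      by (simp add: strategy_def)
  qed
  show ?thesis
    unfolding joint_strategy_def * by blast
qed

lemma joint_strategy_exists: "\<exists>F. joint_strategy M G F"
proof
  \<comment> \<open>The choice depends on \<open>h\<close> only through the set of available
    actions, which \<open>indist_avail\<close> makes equal at indistinguishable states; this gives
    uniformity.\<close>
  let ?F = "\<lambda>i h. SOME a. a \<in> avail M i (hlast h)"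
  have "?F i (segment \<rho> 0 n) \<in> avail M i (pstate \<rho> n)" if "i \<in> G" "\<rho> \<in> paths M" for i \<rho> n
    using that avail_nonempty G_subset path_state by (simp add: some_in_eq subsetD)
  moreover have "?F i (segment \<rho> 0 n) = ?F i (segment \<sigma> 0 n)" if "i \<in> G" "sim n \<rho> \<sigma>" for i \<rho> \<sigma> n
    using that indist_avail [of i "pstate \<rho> n" "pstate \<sigma> n"] G_subset by (auto simp: sim_iff)
  ultimately show "joint_strategy M G ?F"
    unfolding joint_strategy_iff by blast
qed

section \<open>Paths that follow a joint strategy\<close>

definition follows ::
  "('ag \<Rightarrow> ('ag, 's, 'act) hist \<Rightarrow> 'act) \<Rightarrow> nat \<Rightarrow> ('ag, 's, 'act) path \<Rightarrow> bool" where
  "follows F j \<tau> \<longleftrightarrow> (\<forall>i\<in>G. \<forall>t\<ge>j. F i (segment \<tau> 0 t) = pact \<tau> t i)"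

lemma joint_outcomes_segment:
  "\<tau> \<in> joint_outcomes M (segment \<sigma> 0 j) G F \<longleftrightarrow>
     \<tau> \<in> paths M \<and> segment \<tau> 0 j = segment \<sigma> 0 j \<and> follows F j \<tau>"
  using G_nonempty by (auto simp: joint_outcomes_def outcomes_def follows_def)

text \<open>Ensures that a condition on all outcomes is never vacuous: after the history of
  \<open>\<sigma>\<close> up to \<open>j\<close>, the group plays \<open>F\<close> and the other
  agents make arbitrary available moves.\<close>

lemma follows_exists:
  assumes F: "joint_strategy M G F" and \<sigma>: "\<sigma> \<in> paths M"
  obtains \<tau> where "\<tau> \<in> paths M" "segment \<tau> 0 j = segment \<sigma> 0 j" "follows F j \<tau>"
proof -
  \<comment> \<open>The test for availability is a guard: \<open>F\<close> is known to be legal only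
    on histories, while \<open>path_of_rule\<close> requires a legal profile for every
    \<open>h\<close> ending in a state of \<open>M\<close>.\<close>
  define r where "r = (\<lambda>h. \<lambda>i\<in>agents M. if i \<in> G \<and> F i h \<in> avail M i (hlast h) then F i h
    else SOME b. b \<in> avail M i (hlast h))"
  \<comment> \<open>The first \<open>j\<close> steps replay \<open>\<sigma>\<close>, with a similar
    guard; from stage \<open>j\<close> on the rule is \<open>r\<close>.\<close>
  define a where "a = (\<lambda>h. if hlen h < j \<and> pact \<sigma> (hlen h) \<in> profiles M (hlast h)
    then pact \<sigma> (hlen h) else r h)"
  have "r h \<in> profiles M (hlast h)" if "hlast h \<in> states M" for h
    using that avail_nonempty by (auto simp: r_def profiles_def some_in_eq)
  then have a_profile: "a h \<in> profiles M (hlast h)" if "hlast h \<in> states M" for h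
    using that by (simp add: a_def)
  obtain \<tau> where \<tau>: "\<tau> \<in> paths M" and \<tau>0: "pstate \<tau> 0 = pstate \<sigma> 0"
    and act: "\<And>n. pact \<tau> n = a (segment \<tau> 0 n)"
    using path_of_rule [where a = a, OF path_state [OF \<sigma>] a_profile] by metis
  have step: "pact \<tau> n = pact \<sigma> n \<and> pstate \<tau> (Suc n) = pstate \<sigma> (Suc n)"
    if "n < j" "pstate \<tau> n = pstate \<sigma> n" for n
  proof -
    have "pact \<tau> n = pact \<sigma> n"
      using that \<sigma> by (simp add: act a_def paths_def)
    then show ?thesis
      using that \<sigma> \<tau> by (auto simp: paths_def dest!: spec [of _ n])
  qed
  have st: "pstate \<tau> n = pstate \<sigma> n" if "n \<le> j" for n
    using that by (induction n) (simp_all add: \<tau>0 step)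
  show ?thesis
  proof
    show "\<tau> \<in> paths M" by fact
    show "segment \<tau> 0 j = segment \<sigma> 0 j"
      using st step by (simp add: segment_eq_iff)
    show "follows F j \<tau>"
      unfolding follows_def
    proof (intro ballI allI impI)
      fix i t assume i: "i \<in> G" and "j \<le> t"
      then have "pact \<tau> t i = r (segment \<tau> 0 t) i"
        by (simp add: act a_def)
      also have "\<dots> = F i (segment \<tau> 0 t)"
        using F i \<tau> G_subset by (simp add: r_def joint_strategy_iff subsetD)
      finally show "F i (segment \<tau> 0 t) = pact \<tau> t i" ..
    qed
  qed
qed

text \<open>Merges the two path quantifiers of the semantics into one. The target \<open>P\<close>
  speaks of whole paths and not of \<open>j\<close>, so the same target can be considered at stages
  \<open>j\<close> and \<open>Suc j\<close>.\<close>

definition enforces ::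
  "('ag \<Rightarrow> ('ag, 's, 'act) hist \<Rightarrow> 'act) \<Rightarrow> nat \<Rightarrow> ('ag, 's, 'act) path \<Rightarrow>
     (('ag, 's, 'act) path \<Rightarrow> bool) \<Rightarrow> bool" where
  "enforces F j \<rho> P \<longleftrightarrow> joint_strategy M G F \<and>
     (\<forall>\<tau>\<in>paths M. sim j \<rho> \<tau> \<longrightarrow> follows F j \<tau> \<longrightarrow> P \<tau>)"

lemma outcomes_enforces:
  "(joint_strategy M G F \<and>
     (\<forall>\<sigma>\<in>path_class M G j \<rho>. \<forall>\<tau>\<in>joint_outcomes M (segment \<sigma> 0 j) G F. P \<tau>)) \<longleftrightarrow>
   enforces F j \<rho> P"
proof -
  have "(\<forall>\<sigma>\<in>path_class M G j \<rho>. \<forall>\<tau>\<in>joint_outcomes M (segment \<sigma> 0 j) G F. P \<tau>) \<longleftrightarrow>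
      (\<forall>\<tau>\<in>paths M. sim j \<rho> \<tau> \<longrightarrow> follows F j \<tau> \<longrightarrow> P \<tau>)" (is "?L \<longleftrightarrow> ?R")
  proof (intro iffI ballI impI)
    fix \<tau> assume ?L "\<tau> \<in> paths M" "sim j \<rho> \<tau>" "follows F j \<tau>"
    \<comment> \<open>The intermediate path of the semantics is taken to be \<open>\<tau>\<close>
      itself.\<close>
    moreover from this have "\<tau> \<in> path_class M G j \<rho>" "\<tau> \<in> joint_outcomes M (segment \<tau> 0 j) G F"
      by (simp_all add: path_class_iff joint_outcomes_segment)
    ultimately show "P \<tau>" by blast
  next
    fix \<sigma> \<tau> assume R: ?R and "\<sigma> \<in> path_class M G j \<rho>"
      "\<tau> \<in> joint_outcomes M (segment \<sigma> 0 j) G F"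
    then have "\<tau> \<in> paths M" "sim j \<rho> \<tau>" "follows F j \<tau>"
      by (simp_all add: path_class_iff joint_outcomes_segment sim_def)
    with R show "P \<tau>" by blast
  qed
  then show ?thesis
    by (simp only: enforces_def)
qed

lemma sat_Next: "sat M \<rho> j (Next G \<phi>) \<longleftrightarrow> (\<exists>F. enforces F j \<rho> (\<lambda>\<tau>. sat M \<tau> (Suc j) \<phi>))"
  by (simp only: sat.simps outcomes_enforces Suc_eq_plus1)

lemma sat_Always: "sat M \<rho> j (Always G \<phi>) \<longleftrightarrow> (\<exists>F. enforces F j \<rho> (\<lambda>\<tau>. \<forall>k\<ge>j. sat M \<tau> k \<phi>))"
  by (simp only: sat.simps outcomes_enforces Suc_eq_plus1)

lemma sat_Until:
  "sat M \<rho> j (Until G \<phi> \<psi>) \<longleftrightarrow>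
     (\<exists>F. enforces F j \<rho> (\<lambda>\<tau>. \<exists>k\<ge>j. sat M \<tau> k \<psi> \<and> (\<forall>t. j \<le> t \<and> t < k \<longrightarrow> sat M \<tau> t \<phi>)))"
  by (simp only: sat.simps outcomes_enforces Suc_eq_plus1)

lemmas sat_NextI = sat_Next [THEN iffD2, OF exI]
lemmas sat_AlwaysI = sat_Always [THEN iffD2, OF exI]
lemmas sat_UntilI = sat_Until [THEN iffD2, OF exI]

declare sat.simps(4-6) [simp del]

lemma enforces_mono:
  "enforces F j \<rho> P \<Longrightarrow> (\<And>\<tau>. \<tau> \<in> paths M \<Longrightarrow> sim j \<rho> \<tau> \<Longrightarrow> P \<tau> \<Longrightarrow> Q \<tau>) \<Longrightarrow> enforces F j \<rho> Q"
  by (auto simp: enforces_def)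

text \<open>Both sides quantify over the same class of paths. This is what allows a strategy to be
  chosen by class when strategies are glued.\<close>

lemma enforces_sim: "sim j \<rho> \<sigma> \<Longrightarrow> enforces F j \<rho> = enforces F j \<sigma>"
proof -
  assume "sim j \<rho> \<sigma>"
  then have "sim j \<rho> \<tau> \<longleftrightarrow> sim j \<sigma> \<tau>" for \<tau>
    using sim_sym sim_trans by blast
  then show ?thesis
    by (simp add: enforces_def fun_eq_iff)
qed

text \<open>A strategy started at \<open>j\<close> cannot influence stage \<open>j\<close>: some
  path following it shares the history of \<open>\<sigma>\<close>, and satisfaction at
  \<open>j\<close> depends only on that history.\<close>

lemma enforces_present:
  assumes F: "enforces F j \<rho> (\<lambda>\<tau>. sat M \<tau> j \<phi>)"
    and \<sigma>: "\<sigma> \<in> paths M" "sim j \<rho> \<sigma>"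
  shows "sat M \<sigma> j \<phi>"
proof -
  have "joint_strategy M G F"
    using F by (simp add: enforces_def)
  then obtain \<tau> where \<tau>: "\<tau> \<in> paths M" "segment \<tau> 0 j = segment \<sigma> 0 j" "follows F j \<tau>"
    using \<sigma>(1) by (rule follows_exists)
  have "sim j \<rho> \<tau>"
    using \<sigma>(2) \<tau>(2) by (simp add: sim_def)
  then have "sat M \<tau> j \<phi>"
    using F \<tau> by (simp add: enforces_def)
  then show ?thesis
    using sat_segment_cong [OF \<tau>(2), of M \<phi>] by blast
qed

lemma sat_Dist: "sat M \<rho> j (Dist G \<phi>) \<longleftrightarrow> (\<forall>\<sigma>\<in>paths M. sim j \<rho> \<sigma> \<longrightarrow> sat M \<sigma> j \<phi>)"
proof
  assume "sat M \<rho> j (Dist G \<phi>)"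
  then obtain F where "enforces F j \<rho>
      (\<lambda>\<tau>. \<exists>k\<ge>j. sat M \<tau> k \<phi> \<and> (\<forall>t. j \<le> t \<and> t < k \<longrightarrow> sat M \<tau> t \<phi>))"
    unfolding Dist_def sat_Until by blast
  then have "enforces F j \<rho> (\<lambda>\<tau>. sat M \<tau> j \<phi>)"
    \<comment> \<open>Either the witness \<open>k\<close> is \<open>j\<close>, or
      \<open>j < k\<close> and the left argument holds at \<open>t = j\<close>; both arguments are
      \<open>\<phi>\<close>.\<close>
    by (rule enforces_mono) (metis le_neq_implies_less le_refl)
  then show "\<forall>\<sigma>\<in>paths M. sim j \<rho> \<sigma> \<longrightarrow> sat M \<sigma> j \<phi>"
    using enforces_present by blast
next
  assume *: "\<forall>\<sigma>\<in>paths M. sim j \<rho> \<sigma> \<longrightarrow> sat M \<sigma> j \<phi>"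
  obtain F where "joint_strategy M G F"
    using joint_strategy_exists by blast
  with * have "enforces F j \<rho>
      (\<lambda>\<tau>. \<exists>k\<ge>j. sat M \<tau> k \<phi> \<and> (\<forall>t. j \<le> t \<and> t < k \<longrightarrow> sat M \<tau> t \<phi>))"
    by (auto simp: enforces_def intro: exI [of _ j])
  then show "sat M \<rho> j (Dist G \<phi>)"
    unfolding Dist_def by (rule sat_UntilI)
qed

text \<open>A path indistinguishable at \<open>Suc j\<close> from an outcome \<open>\<tau>\<close>
  shows the same group actions at stage \<open>j\<close>. By uniformity \<open>F\<close> prescribes
  these actions there too, so that path has followed \<open>F\<close> since
  \<open>j\<close>.\<close>

lemma enforces_Suc:
  assumes F: "enforces F j \<rho> P"
  shows "enforces F j \<rho> (\<lambda>\<tau>. enforces F (Suc j) \<tau> P)"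
  unfolding enforces_def
proof (intro conjI ballI impI)
  show strat: "joint_strategy M G F" and "joint_strategy M G F"
    using F by (simp_all add: enforces_def)
  fix \<tau> \<upsilon>
  assume \<tau>: "\<tau> \<in> paths M" "sim j \<rho> \<tau>" "follows F j \<tau>"
    and \<upsilon>: "\<upsilon> \<in> paths M" and sim: "sim (Suc j) \<tau> \<upsilon>" and fol: "follows F (Suc j) \<upsilon>"
  have sim_j: "sim j \<tau> \<upsilon>"
    using sim_mono [OF sim] by simp
  have "F i (segment \<upsilon> 0 j) = pact \<upsilon> j i" if "i \<in> G" for i
  proof -
    have "F i (segment \<upsilon> 0 j) = F i (segment \<tau> 0 j)"
      using strat that \<tau>(1) \<upsilon> sim_j by (metis joint_strategy_iff)
    also have "\<dots> = pact \<tau> j i"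
      using \<tau>(3) that by (simp add: follows_def)
    \<comment> \<open>Indistinguishability at \<open>Suc j\<close> includes the agents' own actions
      at stage \<open>j\<close>.\<close>
    also have "\<dots> = pact \<upsilon> j i"
      using sim that by (simp add: sim_iff)
    finally show ?thesis .
  qed
  then have "follows F j \<upsilon>"
    using fol by (auto simp: follows_def) (metis not_less_eq_eq le_antisym)
  then show "P \<upsilon>"
    using F \<upsilon> sim_trans [OF \<tau>(2) sim_j] by (simp add: enforces_def)
qed

lemma enforces_glue:
  assumes F: "enforces F j \<rho> (\<lambda>\<tau>. \<exists>F'. enforces F' (Suc j) \<tau> P)"
  shows "\<exists>F'. enforces F' j \<rho> P"
proof -
  have strat: "joint_strategy M G F"
    using F by (simp add: enforces_def)
  \<comment> \<open>The first conjunct provides a default: where \<open>P\<close> cannot be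
    enforced, \<open>S \<tau>\<close> is still some joint strategy, so the glued strategy is legal
    everywhere.\<close>
  define S where "S \<tau> = (SOME F'. joint_strategy M G F' \<and>
    ((\<exists>F''. enforces F'' (Suc j) \<tau> P) \<longrightarrow> enforces F' (Suc j) \<tau> P))" for \<tau>
  have S: "joint_strategy M G (S \<tau>) \<and>
      ((\<exists>F''. enforces F'' (Suc j) \<tau> P) \<longrightarrow> enforces (S \<tau>) (Suc j) \<tau> P)" for \<tau>
  proof -
    have "\<exists>F'. joint_strategy M G F' \<and>
        ((\<exists>F''. enforces F'' (Suc j) \<tau> P) \<longrightarrow> enforces F' (Suc j) \<tau> P)"
      using joint_strategy_exists by (metis enforces_def)
    then show ?thesis
      unfolding S_def by (rule someI_ex)
  qed
  have S_sim: "S \<tau> = S \<upsilon>" if "sim (Suc j) \<tau> \<upsilon>" for \<tau> \<upsilon>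
    \<comment> \<open>The two \<open>SOME\<close> predicates coincide, hence so do the chosen
      strategies.\<close>
    using enforces_sim [OF that] by (simp add: S_def)
  \<comment> \<open>Any path with the given first \<open>Suc j\<close> steps will do, since all of
    them lie in one class and \<open>S\<close> is constant on it.\<close>
  define rep where "rep h = (SOME \<tau>. \<tau> \<in> paths M \<and> segment \<tau> 0 (Suc j) = htake (Suc j) h)" for h
  \<comment> \<open>The bound is inclusive: the action at stage \<open>j\<close> still comes from
    \<open>F\<close>, and the continuation takes over at \<open>Suc j\<close>.\<close>
  define F' where "F' = (\<lambda>i h. if hlen h \<le> j then F i h else S (rep h) i h)"
  have F'_less: "F' i (segment \<tau> 0 n) = F i (segment \<tau> 0 n)" if "n \<le> j" for i n \<tau>
    using that by (simp add: F'_def)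
  have F'_ge: "F' i (segment \<tau> 0 n) = S \<tau> i (segment \<tau> 0 n)"
    if "\<tau> \<in> paths M" "Suc j \<le> n" for i n \<tau>
  proof -
    have "rep (segment \<tau> 0 n) \<in> paths M \<and> segment (rep (segment \<tau> 0 n)) 0 (Suc j) = segment \<tau> 0 (Suc j)"
      unfolding rep_def htake_segment min_absorb1 [OF that(2)]
      by (rule someI [where x = \<tau>]) (simp add: that)
    then have "sim (Suc j) (rep (segment \<tau> 0 n)) \<tau>"
      using sim_refl [OF that(1), of "Suc j"] by (simp add: sim_def)
    then show ?thesis
      using that S_sim by (simp add: F'_def)
  qed
  have "joint_strategy M G F'"
    unfolding joint_strategy_iff
  proof (intro conjI ballI allI impI)
    fix i \<tau> n assume "i \<in> G" "\<tau> \<in> paths M"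
    then show "F' i (segment \<tau> 0 n) \<in> avail M i (pstate \<tau> n)"
      using strat S [of \<tau>] F'_less [of n i \<tau>] F'_ge [of \<tau> n i]
      by (cases "n \<le> j") (auto simp: joint_strategy_iff)
  next
    fix i \<tau> \<upsilon> n assume *: "i \<in> G" "\<tau> \<in> paths M" "\<upsilon> \<in> paths M" "sim n \<tau> \<upsilon>"
    show "F' i (segment \<tau> 0 n) = F' i (segment \<upsilon> 0 n)"
    proof (cases "n \<le> j")
      case True
      then show ?thesis
        using strat * by (metis F'_less joint_strategy_iff)
    next
      case False
      \<comment> \<open>Beyond stage \<open>j\<close>, indistinguishability at \<open>n\<close>
        restricts to \<open>Suc j\<close>, so both histories use the same continuation, itself
        uniform.\<close>
      then have "S \<tau> = S \<upsilon>"
        using S_sim sim_mono [OF *(4), of "Suc j"] by simp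
      moreover have "S \<upsilon> i (segment \<tau> 0 n) = S \<upsilon> i (segment \<upsilon> 0 n)"
        using S [of \<upsilon>] * by (metis joint_strategy_iff)
      ultimately show ?thesis
        using False * by (simp add: F'_ge)
    qed
  qed
  moreover have "P \<tau>" if \<tau>: "\<tau> \<in> paths M" "sim j \<rho> \<tau>" "follows F' j \<tau>" for \<tau>
  proof -
    text \<open>The path \<open>\<tau>\<close> follows \<open>F\<close> at stage \<open>j\<close> only, so \<open>F\<close> is applied to a path \<open>\<upsilon>\<close> that agrees
      with \<open>\<tau>\<close> up to stage \<open>j + 1\<close> and follows \<open>F\<close> forever.\<close>
    obtain \<upsilon> where \<upsilon>: "\<upsilon> \<in> paths M" "segment \<upsilon> 0 (Suc j) = segment \<tau> 0 (Suc j)"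
      "follows F (Suc j) \<upsilon>"
      using follows_exists [OF strat \<tau>(1)] by blast
    have seg_j: "segment \<upsilon> 0 j = segment \<tau> 0 j" and act_j: "pact \<upsilon> j = pact \<tau> j"
      using \<upsilon>(2) by (simp_all add: segment_eq_iff)
    have "F i (segment \<upsilon> 0 j) = pact \<upsilon> j i" if "i \<in> G" for i
      using \<tau>(3) that F'_less [of j i \<tau>] by (simp add: follows_def seg_j act_j)
    then have "follows F j \<upsilon>"
      using \<upsilon>(3) by (auto simp: follows_def) (metis not_less_eq_eq le_antisym)
    moreover have "sim j \<rho> \<upsilon>"
      using \<tau>(2) seg_j by (simp add: sim_def)
    ultimately have "\<exists>F'. enforces F' (Suc j) \<upsilon> P"
      using F \<upsilon>(1) by (simp add: enforces_def)
    moreover have "sim (Suc j) \<upsilon> \<tau>"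
      using sim_refl [OF \<tau>(1), of "Suc j"] \<upsilon>(2) by (simp add: sim_def)
    ultimately have "enforces (S \<tau>) (Suc j) \<tau> P"
      using S [of \<tau>] enforces_sim by simp
    moreover have "follows (S \<tau>) (Suc j) \<tau>"
      using \<tau> by (simp add: follows_def F'_ge [symmetric])
    ultimately show ?thesis
      using \<tau>(1) sim_refl by (simp add: enforces_def)
  qed
  ultimately have "enforces F' j \<rho> P"
    by (simp add: enforces_def)
  then show ?thesis
    by - (rule exI)
qed

section \<open>Unfolding and folding of the temporal operators\<close>

lemma Always_fixpoint:
  "sat M \<rho> j (Always G \<phi>) \<longleftrightarrow> sat M \<rho> j (Dist G \<phi>) \<and> sat M \<rho> j (Next G (Always G \<phi>))"
proof (intro iffI conjI)
  assume "sat M \<rho> j (Always G \<phi>)"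
  then obtain F where F: "enforces F j \<rho> (\<lambda>\<tau>. \<forall>k\<ge>j. sat M \<tau> k \<phi>)"
    by (auto simp: sat_Always)
  show "sat M \<rho> j (Dist G \<phi>)"
    unfolding sat_Dist using enforces_present [OF enforces_mono [OF F]] by blast
  \<comment> \<open>The bound is raised first, so that \<open>enforces_Suc\<close> yields exactly
    the condition for \<open>Always\<close> at stage \<open>Suc j\<close>.\<close>
  have "enforces F j \<rho> (\<lambda>\<tau>. \<forall>k\<ge>Suc j. sat M \<tau> k \<phi>)"
    by (rule enforces_mono [OF F]) simp
  from enforces_Suc [OF this] have "enforces F j \<rho> (\<lambda>\<tau>. sat M \<tau> (Suc j) (Always G \<phi>))"
    by (rule enforces_mono) (rule sat_AlwaysI)
  then show "sat M \<rho> j (Next G (Always G \<phi>))"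
    by (rule sat_NextI)
next
  assume *: "sat M \<rho> j (Dist G \<phi>) \<and> sat M \<rho> j (Next G (Always G \<phi>))"
  then obtain F0 where
    "enforces F0 j \<rho> (\<lambda>\<tau>. \<exists>F. enforces F (Suc j) \<tau> (\<lambda>\<tau>. \<forall>k\<ge>Suc j. sat M \<tau> k \<phi>))"
    unfolding sat_Next sat_Always by blast
  from enforces_glue [OF this] obtain F where F: "enforces F j \<rho> (\<lambda>\<tau>. \<forall>k\<ge>Suc j. sat M \<tau> k \<phi>)"
    by blast
  have "enforces F j \<rho> (\<lambda>\<tau>. \<forall>k\<ge>j. sat M \<tau> k \<phi>)"
  proof (rule enforces_mono [OF F], intro allI impI)
    fix \<tau> k assume "\<tau> \<in> paths M" "sim j \<rho> \<tau>" "\<forall>k\<ge>Suc j. sat M \<tau> k \<phi>" "j \<le> k"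
    then show "sat M \<tau> k \<phi>"
      \<comment> \<open>Gluing covers the stages after \<open>j\<close>; stage \<open>j\<close>
        itself comes from \<open>Dist\<close>.\<close>
      using * by (cases "k = j") (simp_all add: sat_Dist)
  qed
  then show "sat M \<rho> j (Always G \<phi>)"
    by (rule sat_AlwaysI)
qed

text \<open>If \<open>Dist_dual\<close> fails, \<open>\<psi>\<close> is false throughout the class
  at stage \<open>j\<close>. No outcome can then have \<open>j\<close> as its witness, so
  \<open>\<phi>\<close> holds at \<open>j\<close> and the until condition remains from
  \<open>Suc j\<close>.\<close>

lemma Until_unfold:
  assumes "sat M \<rho> j (Until G \<phi> \<psi>)" and not_dual: "\<not> sat M \<rho> j (Dist_dual G \<psi>)"
  shows "sat M \<rho> j (Dist G \<phi>)" and "sat M \<rho> j (Next G (Until G \<phi> \<psi>))"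
proof -
  have neg: "\<not> sat M \<sigma> j \<psi>" if "\<sigma> \<in> paths M" "sim j \<rho> \<sigma>" for \<sigma>
    using not_dual that by (simp add: Dist_dual_def sat_Dist)
  let ?U = "\<lambda>j \<tau>. \<exists>k\<ge>j. sat M \<tau> k \<psi> \<and> (\<forall>t. j \<le> t \<and> t < k \<longrightarrow> sat M \<tau> t \<phi>)"
  obtain F where F: "enforces F j \<rho> (?U j)"
    using assms(1) by (auto simp: sat_Until)
  have F': "enforces F j \<rho> (\<lambda>\<tau>. sat M \<tau> j \<phi> \<and> ?U (Suc j) \<tau>)"
  proof (rule enforces_mono [OF F])
    fix \<tau> assume "\<tau> \<in> paths M" "sim j \<rho> \<tau>" "?U j \<tau>"
    then obtain k where k: "k \<ge> j" "sat M \<tau> k \<psi>" "\<And>t. j \<le> t \<Longrightarrow> t < k \<Longrightarrow> sat M \<tau> t \<phi>"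
      and "k \<noteq> j"
      using neg by blast
    then have "Suc j \<le> k" by simp
    then show "sat M \<tau> j \<phi> \<and> ?U (Suc j) \<tau>"
      using k by auto
  qed
  show "sat M \<rho> j (Dist G \<phi>)"
    unfolding sat_Dist using enforces_present [OF enforces_mono [OF F']] by blast
  have "enforces F j \<rho> (?U (Suc j))"
    by (rule enforces_mono [OF F']) blast
  from enforces_Suc [OF this] have "enforces F j \<rho> (\<lambda>\<tau>. sat M \<tau> (Suc j) (Until G \<phi> \<psi>))"
    by (rule enforces_mono) (rule sat_UntilI)
  then show "sat M \<rho> j (Next G (Until G \<phi> \<psi>))"
    by (rule sat_NextI)
qed

text \<open>In the first case any joint strategy succeeds at once with witness \<open>j\<close>. In
  the second, the glued strategy secures the until condition from \<open>Suc j\<close>, and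
  \<open>Dist G \<phi>\<close> supplies the missing stage \<open>j\<close>.\<close>

lemma Until_fold:
  assumes "sat M \<rho> j (Dist G \<psi>) \<or>
    sat M \<rho> j (Dist G \<phi>) \<and> sat M \<rho> j (Next G (Until G \<phi> \<psi>))"
  shows "sat M \<rho> j (Until G \<phi> \<psi>)"
proof -
  let ?U = "\<lambda>j \<tau>. \<exists>k\<ge>j. sat M \<tau> k \<psi> \<and> (\<forall>t. j \<le> t \<and> t < k \<longrightarrow> sat M \<tau> t \<phi>)"
  show ?thesis
    using assms
  proof
    assume "sat M \<rho> j (Dist G \<psi>)"
    moreover obtain F where "joint_strategy M G F"
      using joint_strategy_exists by blast
    ultimately have "enforces F j \<rho> (?U j)"
      by (auto simp: enforces_def sat_Dist intro: exI [of _ j])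
    then show ?thesis
      by (rule sat_UntilI)
  next
    assume *: "sat M \<rho> j (Dist G \<phi>) \<and> sat M \<rho> j (Next G (Until G \<phi> \<psi>))"
    then obtain F0 where "enforces F0 j \<rho> (\<lambda>\<tau>. \<exists>F. enforces F (Suc j) \<tau> (?U (Suc j)))"
      unfolding sat_Next sat_Until by blast
    from enforces_glue [OF this] obtain F where F: "enforces F j \<rho> (?U (Suc j))"
      by blast
    have "enforces F j \<rho> (?U j)"
    proof (rule enforces_mono [OF F])
      fix \<tau> assume "\<tau> \<in> paths M" "sim j \<rho> \<tau>" and U: "?U (Suc j) \<tau>"
      then have now: "sat M \<tau> j \<phi>"
        using * by (simp add: sat_Dist)
      obtain k where k: "Suc j \<le> k" "sat M \<tau> k \<psi>" "\<forall>t. Suc j \<le> t \<and> t < k \<longrightarrow> sat M \<tau> t \<phi>"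
        using U by blast
      have "sat M \<tau> t \<phi>" if "j \<le> t" "t < k" for t
        using now k(3) that by (cases "t = j") simp_all
      with k show "?U j \<tau>"
        by (intro exI [of _ k]) simp
    qed
    then show ?thesis
      by (rule sat_UntilI)
  qed
qed

text \<open>Reduces the claims about \<open>Eventually\<close> to those about \<open>Until\<close>
  with left argument \<open>Top \<Phi>\<close>, whose extra \<open>Dist\<close> conjunct is always
  true.\<close>

lemma sat_Dist_Top: "sat M \<rho> j (Dist G (Top \<Phi>))"
  by (simp add: sat_Dist)

end

theorem theorem1:
  fixes N G :: "'ag set" and \<Phi> :: "'p set" and \<phi> \<psi> :: "('p, 'ag) fm"
  assumes "finite N" and "N \<noteq> {}" and "countable \<Phi>"
    and "G \<noteq> {}" and "G \<subseteq> N"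
    and "\<phi> \<in> lang N \<Phi>" and "\<psi> \<in> lang N \<Phi>"
  shows
    "valid TYPE('s) TYPE('act) N \<Phi>
       (Iff (Always G \<phi>) (And (Dist G \<phi>) (Next G (Always G \<phi>)))) \<and>
     valid TYPE('s) TYPE('act) N \<Phi>
       (Imp (Eventually \<Phi> G \<phi>) (Or (Dist_dual G \<phi>) (Next G (Eventually \<Phi> G \<phi>)))) \<and>
     valid TYPE('s) TYPE('act) N \<Phi>
       (Imp (Or (Dist G \<phi>) (Next G (Eventually \<Phi> G \<phi>))) (Eventually \<Phi> G \<phi>)) \<and>
     valid TYPE('s) TYPE('act) N \<Phi>
       (Imp (Until G \<phi> \<psi>) (Or (Dist_dual G \<psi>) (And (Dist G \<phi>) (Next G (Until G \<phi> \<psi>))))) \<and>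
     valid TYPE('s) TYPE('act) N \<Phi>
       (Imp (Or (Dist G \<psi>) (And (Dist G \<phi>) (Next G (Until G \<phi> \<psi>)))) (Until G \<phi> \<psi>))"
proof -
  have "sat M \<rho> j (Iff (Always G \<phi>) (And (Dist G \<phi>) (Next G (Always G \<phi>)))) \<and>
     sat M \<rho> j (Imp (Eventually \<Phi> G \<phi>) (Or (Dist_dual G \<phi>) (Next G (Eventually \<Phi> G \<phi>)))) \<and>
     sat M \<rho> j (Imp (Or (Dist G \<phi>) (Next G (Eventually \<Phi> G \<phi>))) (Eventually \<Phi> G \<phi>)) \<and>
     sat M \<rho> j (Imp (Until G \<phi> \<psi>) (Or (Dist_dual G \<psi>) (And (Dist G \<phi>) (Next G (Until G \<phi> \<psi>))))) \<and>
     sat M \<rho> j (Imp (Or (Dist G \<psi>) (And (Dist G \<phi>) (Next G (Until G \<phi> \<psi>)))) (Until G \<phi> \<psi>))"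
    if "iCGS M" "agents M = N" for M :: "('p, 'ag, 's, 'act) icgs" and \<rho> j
  proof -
    interpret coalition M G
      using assms that by (simp add: coalition_def coalition_axioms_def)
    show ?thesis
      unfolding Eventually_def sat_Iff sat_Imp sat_Or sat.simps(3)
      using Always_fixpoint Until_unfold Until_fold sat_Dist_Top by blast
  qed
  then show ?thesis
    unfolding valid_def by blast
qed

end
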